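(* The languages $\mathcal{L}^*_{!}$ and $\mathcal{L}^*$ are incomparable in expressive power: $\mathcal{L}^*\not\preccurlyeq\mathcal{L}^*_{!}$ and $\mathcal{L}^*_{!}\not\preccurlyeq\mathcal{L}^*$.
   Context: Fix a finite non-empty set of agents $A$ and a non-empty countable set of atoms $\mathtt{P}$. A model is $M=\langle W,R,V\rangle$ with $W$ non-empty, $R=\{R_i\subseteq W\times W\mid i\in A\}$ arbitrary relations, $V:\mathtt{P}\to\mathcal{P}(W)$; $R_G:=\bigcap_{k\in G}R_k$ (with $R_\emptyset:=W\times W$). $\mathcal{L}_D$: $\varphi::=p\mid\lnot\varphi\mid\varphi\land\varphi\mid D_G\varphi$ ($\emptyset\neq G\subseteq A$), with $(M,w)\Vdash D_G\varphi$ iff $\varphi$ holds at all $u$ with $(w,u)\in R_G$. $\|\chi\|^M$ is the truth set of $\chi$, $\sim^M_\chi:=(\|\chi\|^M\times\|\chi\|^M)\cup(\|\lnot\chi\|^M\times\|\lnot\chi\|^M)$. Partial communication: for $S\subseteq A$, $M^{S,\chi}=\langle W,R^{S,\chi},V\rangle$ with $R^{S,\chi}_i:=R_i\cap(R_S\cup\sim^M_\chi)$. Public announcement: $M^{!\xi}=\langle W,R^{!\xi},V\rangle$ with $R^{!\xi}_i:=R_i\cap\sim^M_\xi$. $\mathcal{L}^*$ is $\bigcup_n\mathcal{L}^{*,n}$, where $\mathcal{L}^{*,0}$ is $\mathcal{L}_D$ extended with $[S]\varphi$ ($S\subseteq A$), and $\mathcal{L}^{*,n+1}$ extends $\mathcal{L}^{*,n}$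 with $[S,\chi]\varphi$ for $\chi\in\mathcal{L}^{*,n}$; $(M,w)\Vdash[S,\chi]\varphi$ iff $(M^{S,\chi},w)\Vdash\varphi$, and $(M,w)\Vdash[S]\varphi$ iff $(M^{S,\chi},w)\Vdash\varphi$ for every $\chi\in\mathcal{L}_D$. $\mathcal{L}_{!}$ is $\bigcup_n\mathcal{L}_!^n$ with $\mathcal{L}_!^0=\mathcal{L}_D$ and $\mathcal{L}_!^{n+1}$ extending $\mathcal{L}_!^n$ with $[\xi]\varphi$ for $\xi\in\mathcal{L}_!^n$, where $(M,w)\Vdash[\xi]\varphi$ iff $(M,w)\Vdash\xi$ implies $(M^{!\xi},w)\Vdash\varphi$. $\mathcal{L}^*_{!}$ extends $\mathcal{L}_{!}$ with a modality $[!*]$: $(M,w)\Vdash[!*]\varphi$ iff $(M,w)\Vdash[\chi]\varphi$ for every $\chi\in\mathcal{L}_D$. For languages interpreted over pointed models, $\mathcal{L}_1\preccurlyeq\mathcal{L}_2$ iff every $\alpha_1\in\mathcal{L}_1$ has some $\alpha_2\in\mathcal{L}_2$ with the same truth value in every pointed model.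
   Formalization: At least two agents are assumed: with a single agent, partial communication changes no model, so L^* is only as expressive as L_D, hence L^* ≼ L^*_! and the incomparability fails. *)

theory Defs
  imports Main "HOL-Library.Countable" "HOL-Library.Cardinality"
begin

text \<open>Agents and atoms are the types \<open>'a\<close> and \<open>'p\<close>; the worlds of a model are a
  subset of the type \<open>'w\<close>.\<close>

record ('w, 'a, 'p) model =
  worlds :: "'w set"
  rel :: "'a \<Rightarrow> ('w \<times> 'w) set"
  val :: "'p \<Rightarrow> 'w set"

definition is_model :: "('w, 'a, 'p) model \<Rightarrow> bool" where
  "is_model M \<longleftrightarrow> worlds M \<noteq> {} \<and>
     (\<forall>i. rel M i \<subseteq> worlds M \<times> worlds M) \<and> (\<forall>p. val M p \<subseteq> worlds M)"

text \<open>The first factor matters only for empty \<open>G\<close>, where the relation is the total one.\<close>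

definition group_rel :: "('w, 'a, 'p) model \<Rightarrow> 'a set \<Rightarrow> ('w \<times> 'w) set" where
  "group_rel M G = (worlds M \<times> worlds M) \<inter> (\<Inter>k\<in>G. rel M k)"

text \<open>The three operations below take the truth set \<open>X\<close> of the formula concerned.\<close>

definition agree :: "('w, 'a, 'p) model \<Rightarrow> 'w set \<Rightarrow> ('w \<times> 'w) set" where
  "agree M X = (X \<times> X) \<union> ((worlds M - X) \<times> (worlds M - X))"

definition partial_comm ::
    "('w, 'a, 'p) model \<Rightarrow> 'a set \<Rightarrow> 'w set \<Rightarrow> ('w, 'a, 'p) model" where
  "partial_comm M S X = M\<lparr>rel := \<lambda>i. rel M i \<inter> (group_rel M S \<union> agree M X)\<rparr>"

definition announce :: "('w, 'a, 'p) model \<Rightarrow> 'w set \<Rightarrow> ('w, 'a, 'p) model" where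
  "announce M X = M\<lparr>rel := \<lambda>i. rel M i \<inter> agree M X\<rparr>"

text \<open>All languages are carved out of one type of formulas with a common semantics.
  \<open>PComm S \<chi> \<phi>\<close> is $[S,\chi]\varphi$, \<open>APComm S \<phi>\<close> is $[S]\varphi$, \<open>Ann \<xi> \<phi>\<close> is $[\xi]\varphi$
  and \<open>AAnn \<phi>\<close> is $[!*]\varphi$.\<close>

datatype ('a, 'p) fm =
    Atom 'p
  | Neg "('a, 'p) fm"
  | Conj "('a, 'p) fm" "('a, 'p) fm"
  | Dist "'a set" "('a, 'p) fm"
  | PComm "'a set" "('a, 'p) fm" "('a, 'p) fm"
  | APComm "'a set" "('a, 'p) fm"
  | Ann "('a, 'p) fm" "('a, 'p) fm"
  | AAnn "('a, 'p) fm"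

inductive_set L_D :: "('a, 'p) fm set" where
  "Atom p \<in> L_D"
| "\<phi> \<in> L_D \<Longrightarrow> Neg \<phi> \<in> L_D"
| "\<phi> \<in> L_D \<Longrightarrow> \<psi> \<in> L_D \<Longrightarrow> Conj \<phi> \<psi> \<in> L_D"
| "G \<noteq> {} \<Longrightarrow> \<phi> \<in> L_D \<Longrightarrow> Dist G \<phi> \<in> L_D"

text \<open>In the next two definitions \<open>X\<close> is the set of formulas allowed as the content of a
  communication or announcement: no formula at level \<open>0\<close>, and the formulas of the previous
  level afterwards. So communicated formulas may contain $[S]$, and announced ones $[!*]$.\<close>

inductive_set star_over :: "('a, 'p) fm set \<Rightarrow> ('a, 'p) fm set" for X where
  "Atom p \<in> star_over X"
| "\<phi> \<in> star_over X \<Longrightarrow> Neg \<phi> \<in> star_over X"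
| "\<phi> \<in> star_over X \<Longrightarrow> \<psi> \<in> star_over X \<Longrightarrow> Conj \<phi> \<psi> \<in> star_over X"
| "G \<noteq> {} \<Longrightarrow> \<phi> \<in> star_over X \<Longrightarrow> Dist G \<phi> \<in> star_over X"
| "\<phi> \<in> star_over X \<Longrightarrow> APComm S \<phi> \<in> star_over X"
| "\<chi> \<in> X \<Longrightarrow> \<phi> \<in> star_over X \<Longrightarrow> PComm S \<chi> \<phi> \<in> star_over X"

primrec L_star_level :: "nat \<Rightarrow> ('a, 'p) fm set" where
  "L_star_level 0 = star_over {}"
| "L_star_level (Suc n) = star_over (L_star_level n)"

definition L_star :: "('a, 'p) fm set" where
  "L_star = (\<Union>n. L_star_level n)"

inductive_set bang_star_over :: "('a, 'p) fm set \<Rightarrow> ('a, 'p) fm set" for X where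
  "Atom p \<in> bang_star_over X"
| "\<phi> \<in> bang_star_over X \<Longrightarrow> Neg \<phi> \<in> bang_star_over X"
| "\<phi> \<in> bang_star_over X \<Longrightarrow> \<psi> \<in> bang_star_over X \<Longrightarrow> Conj \<phi> \<psi> \<in> bang_star_over X"
| "G \<noteq> {} \<Longrightarrow> \<phi> \<in> bang_star_over X \<Longrightarrow> Dist G \<phi> \<in> bang_star_over X"
| "\<phi> \<in> bang_star_over X \<Longrightarrow> AAnn \<phi> \<in> bang_star_over X"
| "\<xi> \<in> X \<Longrightarrow> \<phi> \<in> bang_star_over X \<Longrightarrow> Ann \<xi> \<phi> \<in> bang_star_over X"

primrec L_bang_star_level :: "nat \<Rightarrow> ('a, 'p) fm set" where
  "L_bang_star_level 0 = bang_star_over {}"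
| "L_bang_star_level (Suc n) = bang_star_over (L_bang_star_level n)"

definition L_bang_star :: "('a, 'p) fm set" where
  "L_bang_star = (\<Union>n. L_bang_star_level n)"

primrec arb_count :: "('a, 'p) fm \<Rightarrow> nat" where
  "arb_count (Atom p) = 0"
| "arb_count (Neg \<phi>) = arb_count \<phi>"
| "arb_count (Conj \<phi> \<psi>) = arb_count \<phi> + arb_count \<psi>"
| "arb_count (Dist G \<phi>) = arb_count \<phi>"
| "arb_count (PComm S \<chi> \<phi>) = arb_count \<chi> + arb_count \<phi>"
| "arb_count (APComm S \<phi>) = Suc (arb_count \<phi>)"
| "arb_count (Ann \<xi> \<phi>) = arb_count \<xi> + arb_count \<phi>"
| "arb_count (AAnn \<phi>) = Suc (arb_count \<phi>)"

lemma arb_count_L_D: "\<chi> \<in> L_D \<Longrightarrow> arb_count \<chi> = 0"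
  by (induction rule: L_D.induct) auto

function sat :: "('w, 'a, 'p) model \<Rightarrow> 'w \<Rightarrow> ('a, 'p) fm \<Rightarrow> bool" where
  "sat M w (Atom p) \<longleftrightarrow> w \<in> val M p"
| "sat M w (Neg \<phi>) \<longleftrightarrow> \<not> sat M w \<phi>"
| "sat M w (Conj \<phi> \<psi>) \<longleftrightarrow> sat M w \<phi> \<and> sat M w \<psi>"
| "sat M w (Dist G \<phi>) \<longleftrightarrow> (\<forall>u. (w, u) \<in> group_rel M G \<longrightarrow> sat M u \<phi>)"
| "sat M w (PComm S \<chi> \<phi>) \<longleftrightarrow> sat (partial_comm M S {u \<in> worlds M. sat M u \<chi>}) w \<phi>"
| "sat M w (APComm S \<phi>) \<longleftrightarrow>
     (\<forall>\<chi>\<in>L_D. sat (partial_comm M S {u \<in> worlds M. sat M u \<chi>}) w \<phi>)"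
| "sat M w (Ann \<xi> \<phi>) \<longleftrightarrow>
     (sat M w \<xi> \<longrightarrow> sat (announce M {u \<in> worlds M. sat M u \<xi>}) w \<phi>)"
| "sat M w (AAnn \<phi>) \<longleftrightarrow> (\<forall>\<chi>\<in>L_D. sat M w (Ann \<chi> \<phi>))"
  by pat_completeness auto
termination
  by (relation "measures [\<lambda>(M, w, \<phi>). arb_count \<phi>, \<lambda>(M, w, \<phi>). size \<phi>]")
    (auto simp: arb_count_L_D)

text \<open>\<open>expr_le TYPE('w) L1 L2\<close> says that \<open>L2\<close> is at least as expressive as \<open>L1\<close> over all
  pointed models whose worlds are drawn from \<open>'w\<close>.\<close>

definition expr_le :: "'w itself \<Rightarrow> ('a, 'p) fm set \<Rightarrow> ('a, 'p) fm set \<Rightarrow> bool" where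
  "expr_le (_ :: 'w itself) L1 L2 \<longleftrightarrow>
     (\<forall>\<alpha>\<^sub>1\<in>L1. \<exists>\<alpha>\<^sub>2\<in>L2. \<forall>M :: ('w, 'a, 'p) model. \<forall>w\<in>worlds M.
        is_model M \<longrightarrow> (sat M w \<alpha>\<^sub>1 \<longleftrightarrow> sat M w \<alpha>\<^sub>2))"

text \<open>With a single agent partial communication is idle, so \<open>L_star\<close> is then no more
  expressive than \<open>L_D\<close>.\<close>

lemma partial_comm_single_agent:
  fixes M :: "('w, 'a, 'p) model"
  assumes "is_model M" and "CARD('a) = 1"
  shows "partial_comm M S X = M"
proof -
  obtain a where "(UNIV :: 'a set) = {a}"
    using assms(2) card_1_singletonE by blast
  then have a: "i = j" for i j :: 'a
    by (metis UNIV_I singletonD)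
  have "rel M i \<subseteq> group_rel M S" for i
    using assms(1) a unfolding is_model_def group_rel_def by (metis INT_greatest Int_greatest equalityD1)
  then have "(\<lambda>i. rel M i \<inter> (group_rel M S \<union> agree M X)) = rel M"
    by auto
  then show ?thesis
    by (simp add: partial_comm_def)
qed

end

theory Submission
  imports Defs
begin

text \<open>
  Both halves use a chain of worlds \<open>\<dots> \<rightarrow> 2 \<rightarrow> 1 \<rightarrow> 0\<close> together with a root that sees some of them.

  For \<open>L_star\<close> against \<open>L_bang_star\<close>, the root sees the chain by \<open>a\<close>, and the chain edges belong
  to the other agents. A communication by \<open>a\<close> can remove every chain edge while the root keeps
  seeing all its successors exactly if a formula of \<open>L_D\<close> alternates along the visible
  part of the chain. This is possible if the visible part is finite and impossible if it is the
  whole chain, since a modal formula is eventually constant in the height. Announcements, in contrast,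
  also hide the worlds on the other side from the root. What the root sees afterwards is, up
  to bisimilarity, again an initial segment of the chain, and any shorter segment can be obtained;
  hence \<open>L_bang_star\<close> cannot tell large finite segments from the infinite one.

  For \<open>L_bang_star\<close> against \<open>L_star\<close>, all agents have the same relation. Then partial communication
  is idle and \<open>L_star\<close> is just modal logic, which cannot distinguish a root seeing the
  heights \<open>n\<close> and \<open>n + 2\<close> from one that sees only \<open>n + 2\<close>. Some announcement
  cuts the chain right below \<open>n + 2\<close> but not below \<open>n\<close>.
\<close>

section \<open>Renaming worlds\<close>

definition map_model :: "('v \<Rightarrow> 'w) \<Rightarrow> ('v, 'a, 'p) model \<Rightarrow> ('w, 'a, 'p) model" where
  "map_model f M = \<lparr>worlds = f ` worlds M, rel = \<lambda>i. map_prod f f ` rel M i, val = \<lambda>p. f ` val M p\<rparr>"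

lemma worlds_map_model [simp]: "worlds (map_model f M) = f ` worlds M"
  by (simp add: map_model_def)

lemma is_model_map_model: "is_model M \<Longrightarrow> is_model (map_model f M)"
  unfolding is_model_def map_model_def by fastforce

lemma group_rel_map_model:
  assumes "inj f"
  shows "group_rel (map_model f M) G = map_prod f f ` group_rel M G"
proof -
  have inj: "inj (map_prod f f)"
    using assms by (simp add: prod.inj_map)
  show ?thesis
  proof (cases "G = {}")
    case True
    then show ?thesis
      by (auto simp: group_rel_def map_model_def)
  next
    case False
    then obtain g where "g \<in> G"
      by blast
    then have "map_prod f f ` group_rel M G =
        map_prod f f ` (worlds M \<times> worlds M) \<inter> (\<Inter>k\<in>G. map_prod f f ` rel M k)"
      using image_INT[OF inj, of G "rel M" g] unfolding group_rel_def by (simp add: image_Int[OF inj])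
    then show ?thesis
      by (simp add: group_rel_def map_model_def map_prod_surj_on)
  qed
qed

lemma agree_map_model:
  assumes "inj f"
  shows "agree (map_model f M) (f ` X) = map_prod f f ` agree M X"
  using assms by (simp add: agree_def map_model_def image_Un map_prod_surj_on image_set_diff)

lemma partial_comm_map_model:
  assumes "inj f"
  shows "partial_comm (map_model f M) S (f ` X) = map_model f (partial_comm M S X)"
proof -
  have "inj (map_prod f f)"
    using assms by (simp add: prod.inj_map)
  then show ?thesis
    unfolding partial_comm_def group_rel_map_model[OF assms] agree_map_model[OF assms]
    by (simp add: map_model_def image_Int image_Un)
qed

lemma announce_map_model:
  assumes "inj f"
  shows "announce (map_model f M) (f ` X) = map_model f (announce M X)"
proof -
  have "inj (map_prod f f)"
    using assms by (simp add: prod.inj_map)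
  then show ?thesis
    unfolding announce_def agree_map_model[OF assms]
    by (simp add: map_model_def image_Int)
qed

lemma sat_map_model:
  assumes "inj f"
  shows "sat (map_model f M) (f w) \<phi> \<longleftrightarrow> sat M w \<phi>"
\<comment> \<open>Induction along the recursion of \<open>sat\<close>: \<open>APComm\<close> and
  \<open>AAnn\<close> need the claim for every formula of \<open>L_D\<close>, not only for
  subformulas.\<close>
proof (induction M w \<phi> rule: sat.induct)
  case (1 M w p)
  then show ?case
    using assms by (auto simp: map_model_def inj_def)
next
  case (4 M w G \<phi>)
  have "(f w, u) \<in> group_rel (map_model f M) G \<longleftrightarrow> (\<exists>v. u = f v \<and> (w, v) \<in> group_rel M G)" for u
    using assms by (auto simp: group_rel_map_model inj_def)
  then show ?case
    using 4 by auto
next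
  case (5 M w S \<chi> \<phi>)
  have "{u \<in> worlds (map_model f M). sat (map_model f M) u \<chi>} = f ` {u \<in> worlds M. sat M u \<chi>}"
    using 5(1) by auto
  then show ?case
    using 5(2) by (simp add: partial_comm_map_model[OF assms])
next
  case (6 M w S \<phi>)
  have "{u \<in> worlds (map_model f M). sat (map_model f M) u \<chi>} = f ` {u \<in> worlds M. sat M u \<chi>}"
    if "\<chi> \<in> L_D" for \<chi>
    using 6(1)[OF that] by auto
  then show ?case
    using 6(2) by (simp add: partial_comm_map_model[OF assms])
next
  case (7 M w \<xi> \<phi>)
  have "{u \<in> worlds (map_model f M). sat (map_model f M) u \<xi>} = f ` {u \<in> worlds M. sat M u \<xi>}"
    if "sat M w \<xi>"
    using 7(2)[OF that] by auto
  then show ?case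
    using 7(1,3) by (simp add: announce_map_model[OF assms])
qed auto

text \<open>An injection of \<open>nat\<close> into \<open>'w\<close> carries models on
  \<open>nat\<close> to models on \<open>'w\<close>, so an equivalence valid over \<open>'w\<close>
  is valid over \<open>nat\<close>. Each candidate \<beta> can thus be refuted by its own pair of
  models on \<open>nat\<close>.\<close>

lemma not_expr_le_natI:
  assumes "infinite (UNIV :: 'w set)" and "\<alpha> \<in> L1"
    and "\<And>\<beta>. \<beta> \<in> L2 \<Longrightarrow> \<exists>(M :: (nat, 'a, 'p) model) (N :: (nat, 'a, 'p) model) u v.
      is_model M \<and> is_model N \<and> u \<in> worlds M \<and> v \<in> worlds N \<and>
      (sat M u \<beta> \<longleftrightarrow> sat N v \<beta>) \<and> sat M u \<alpha> \<and> \<not> sat N v \<alpha>"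
  shows "\<not> expr_le TYPE('w) (L1 :: ('a, 'p) fm set) L2"
proof
  assume "expr_le TYPE('w) L1 L2"
  then obtain \<beta> where "\<beta> \<in> L2" and eq: "\<And>(M :: ('w, 'a, 'p) model) w.
      w \<in> worlds M \<Longrightarrow> is_model M \<Longrightarrow> sat M w \<alpha> \<longleftrightarrow> sat M w \<beta>"
    using assms(2) unfolding expr_le_def by blast
  obtain f :: "nat \<Rightarrow> 'w" where f: "inj f"
    using assms(1) infinite_countable_subset by blast
  have "sat M w \<alpha> \<longleftrightarrow> sat M w \<beta>" if "w \<in> worlds M" "is_model M"
    for M :: "(nat, 'a, 'p) model" and w
    using eq[of "f w" "map_model f M"] that
    by (simp add: is_model_map_model sat_map_model[OF f])
  then show False
    using assms(3)[OF \<open>\<beta> \<in> L2\<close>] by blast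
qed

section \<open>Membership in the languages\<close>

text \<open>The levels are dropped here and in \<open>bang_star_fm\<close> so that invariance can be
  proved by structural induction, which also covers the content of an announcement.\<close>

primrec star_fm :: "('a, 'p) fm \<Rightarrow> bool" where
  "star_fm (Atom p) \<longleftrightarrow> True"
| "star_fm (Neg \<phi>) \<longleftrightarrow> star_fm \<phi>"
| "star_fm (Conj \<phi> \<psi>) \<longleftrightarrow> star_fm \<phi> \<and> star_fm \<psi>"
| "star_fm (Dist G \<phi>) \<longleftrightarrow> G \<noteq> {} \<and> star_fm \<phi>"
| "star_fm (PComm S \<chi> \<phi>) \<longleftrightarrow> star_fm \<chi> \<and> star_fm \<phi>"
| "star_fm (APComm S \<phi>) \<longleftrightarrow> star_fm \<phi>"
| "star_fm (Ann \<xi> \<phi>) \<longleftrightarrow> False"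
| "star_fm (AAnn \<phi>) \<longleftrightarrow> False"

primrec bang_star_fm :: "('a, 'p) fm \<Rightarrow> bool" where
  "bang_star_fm (Atom p) \<longleftrightarrow> True"
| "bang_star_fm (Neg \<phi>) \<longleftrightarrow> bang_star_fm \<phi>"
| "bang_star_fm (Conj \<phi> \<psi>) \<longleftrightarrow> bang_star_fm \<phi> \<and> bang_star_fm \<psi>"
| "bang_star_fm (Dist G \<phi>) \<longleftrightarrow> G \<noteq> {} \<and> bang_star_fm \<phi>"
| "bang_star_fm (PComm S \<chi> \<phi>) \<longleftrightarrow> False"
| "bang_star_fm (APComm S \<phi>) \<longleftrightarrow> False"
| "bang_star_fm (Ann \<xi> \<phi>) \<longleftrightarrow> bang_star_fm \<xi> \<and> bang_star_fm \<phi>"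
| "bang_star_fm (AAnn \<phi>) \<longleftrightarrow> bang_star_fm \<phi>"

lemma star_fm_if_star_over: "\<phi> \<in> star_over X \<Longrightarrow> (\<And>\<chi>. \<chi> \<in> X \<Longrightarrow> star_fm \<chi>) \<Longrightarrow> star_fm \<phi>"
  by (induction rule: star_over.induct) auto

lemma star_fm_if_L_star:
  assumes "\<phi> \<in> L_star"
  shows "star_fm \<phi>"
proof -
  have "\<phi> \<in> L_star_level n \<Longrightarrow> star_fm \<phi>" for n and \<phi> :: "('a, 'p) fm"
    by (induction n arbitrary: \<phi>) (auto intro: star_fm_if_star_over)
  then show ?thesis
    using assms by (auto simp: L_star_def)
qed

lemma bang_star_fm_if_bang_star_over:
  "\<phi> \<in> bang_star_over X \<Longrightarrow> (\<And>\<chi>. \<chi> \<in> X \<Longrightarrow> bang_star_fm \<chi>) \<Longrightarrow> bang_star_fm \<phi>"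
  by (induction rule: bang_star_over.induct) auto

lemma bang_star_fm_if_L_bang_star:
  assumes "\<phi> \<in> L_bang_star"
  shows "bang_star_fm \<phi>"
proof -
  have "\<phi> \<in> L_bang_star_level n \<Longrightarrow> bang_star_fm \<phi>" for n and \<phi> :: "('a, 'p) fm"
    by (induction n arbitrary: \<phi>) (auto intro: bang_star_fm_if_bang_star_over)
  then show ?thesis
    using assms by (auto simp: L_bang_star_def)
qed

lemma bang_star_fm_if_L_D: "\<phi> \<in> L_D \<Longrightarrow> bang_star_fm \<phi>"
  by (induction rule: L_D.induct) auto

lemma star_over_if_L_D: "\<phi> \<in> L_D \<Longrightarrow> \<phi> \<in> star_over X"
  by (induction rule: L_D.induct) (auto intro: star_over.intros)

lemma bang_star_over_if_L_D: "\<phi> \<in> L_D \<Longrightarrow> \<phi> \<in> bang_star_over X"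
  by (induction rule: L_D.induct) (auto intro: bang_star_over.intros)

definition Bot :: "('a, 'p) fm" where
  "Bot = Conj (Atom undefined) (Neg (Atom undefined))"

lemma sat_Bot [simp]: "\<not> sat M w Bot"
  by (simp add: Bot_def)

lemma Bot_in_L_D [simp]: "Bot \<in> L_D"
  by (simp add: Bot_def L_D.intros)

abbreviation boxes :: "'a \<Rightarrow> nat \<Rightarrow> ('a, 'p) fm" where
  "boxes b n \<equiv> (Dist {b} ^^ n) Bot"

lemma boxes_in_L_D [simp]: "boxes b n \<in> L_D"
  by (induction n) (simp_all add: L_D.intros)

section \<open>Rooted chains\<close>

text \<open>World \<open>0\<close> is the root and \<open>Suc k\<close> the chain world \<open>k\<close>. Agents in \<open>J\<close> have the edges from the
  root to the chain worlds in \<open>A\<close>, those in \<open>K\<close> the chain edges from \<open>k + 1\<close> to \<open>k\<close> with \<open>k + 1 \<notin> C\<close>.\<close>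

definition rooted_chain :: "'a set \<Rightarrow> 'a set \<Rightarrow> nat set \<Rightarrow> nat set \<Rightarrow> (nat, 'a, 'p) model" where
  "rooted_chain J K A C = \<lparr>worlds = UNIV,
     rel = \<lambda>i. {(0, Suc k) | k. i \<in> J \<and> k \<in> A} \<union> {(Suc (Suc k), Suc k) | k. i \<in> K \<and> Suc k \<notin> C},
     val = \<lambda>p. {0}\<rparr>"

text \<open>The number of chain edges that can be followed from chain world \<open>k\<close>. As
  every atom is false on the chain, it fixes the world up to bisimilarity.\<close>

primrec height :: "nat set \<Rightarrow> nat \<Rightarrow> nat" where
  "height C 0 = 0"
| "height C (Suc k) = (if Suc k \<in> C then 0 else Suc (height C k))"

text \<open>\<open>C\<close> consists of chain indices and \<open>X\<close> of worlds, whence the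
  shift by one: the edge from \<open>k + 1\<close> to \<open>k\<close> is lost if its ends lie on
  different sides of \<open>X\<close>.\<close>

definition sever :: "nat set \<Rightarrow> nat set \<Rightarrow> nat set" where
  "sever C X = C \<union> {Suc k | k. (Suc (Suc k) \<in> X) \<noteq> (Suc k \<in> X)}"

lemma Suc_in_sever_iff: "Suc k \<in> sever C X \<longleftrightarrow> Suc k \<in> C \<or> (Suc (Suc k) \<in> X) \<noteq> (Suc k \<in> X)"
  by (auto simp: sever_def)

lemma worlds_rooted_chain [simp]: "worlds (rooted_chain J K A C) = UNIV"
  and val_rooted_chain [simp]: "val (rooted_chain J K A C) p = {0}"
  by (simp_all add: rooted_chain_def)

lemma is_model_rooted_chain [simp]: "is_model (rooted_chain J K A C)"
  by (simp add: is_model_def)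

lemma group_rel_rooted_chain:
  assumes "G \<noteq> {}"
  shows "group_rel (rooted_chain J K A C) G =
    {(0, Suc k) | k. G \<subseteq> J \<and> k \<in> A} \<union> {(Suc (Suc k), Suc k) | k. G \<subseteq> K \<and> Suc k \<notin> C}"
proof -
  have "(x, y) \<in> group_rel (rooted_chain J K A C) G \<longleftrightarrow>
      x = 0 \<and> (\<exists>k. y = Suc k \<and> G \<subseteq> J \<and> k \<in> A) \<or>
      x = Suc y \<and> (\<exists>k. y = Suc k \<and> G \<subseteq> K \<and> Suc k \<notin> C)" for x y
    using assms by (cases x; cases y) (auto simp: group_rel_def rooted_chain_def)
  then show ?thesis
    by (auto simp: set_eq_iff)
qed

text \<open>Rooted chains are closed under announcements, so the inductions below can range over all
  \<open>A\<close> and \<open>C\<close>.\<close>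

lemma announce_rooted_chain:
  "announce (rooted_chain J K A C) X =
     rooted_chain J K {k \<in> A. Suc k \<in> X \<longleftrightarrow> 0 \<in> X} (sever C X)"
  by (auto simp: announce_def rooted_chain_def agree_def Suc_in_sever_iff fun_eq_iff)

text \<open>The root edges belong to the communicating agent \<open>a\<close> and survive; no chain
  edge belongs to \<open>a\<close>, so the chain edges must respect \<open>X\<close>.\<close>

lemma partial_comm_rooted_chain:
  "partial_comm (rooted_chain {a} (- {a}) A C) {a} X = rooted_chain {a} (- {a}) A (sever C X)"
  by (auto simp: partial_comm_def group_rel_def rooted_chain_def agree_def Suc_in_sever_iff fun_eq_iff)

text \<open>All agents share one relation, which every \<open>group_rel\<close> contains, also the
  one for empty \<open>S\<close>.\<close>

lemma partial_comm_uniform_rooted_chain: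
  "partial_comm (rooted_chain UNIV UNIV A C) S X = rooted_chain UNIV UNIV A C"
  by (auto simp: partial_comm_def group_rel_def rooted_chain_def)

lemma sat_Dist_root:
  "G \<noteq> {} \<Longrightarrow> sat (rooted_chain J K A C) 0 (Dist G \<phi>) \<longleftrightarrow>
     (G \<subseteq> J \<longrightarrow> (\<forall>k\<in>A. sat (rooted_chain J K A C) (Suc k) \<phi>))"
  by (auto simp: group_rel_rooted_chain)

lemma sat_Dist_chain_0:
  "G \<noteq> {} \<Longrightarrow> height C k = 0 \<Longrightarrow> sat (rooted_chain J K A C) (Suc k) (Dist G \<phi>)"
  by (cases k) (auto simp: group_rel_rooted_chain split: if_splits)

lemma sat_Dist_chain_Suc:
  "G \<noteq> {} \<Longrightarrow> Suc k \<notin> C \<Longrightarrow> sat (rooted_chain J K A C) (Suc (Suc k)) (Dist G \<phi>) \<longleftrightarrow>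
     (G \<subseteq> K \<longrightarrow> sat (rooted_chain J K A C) (Suc k) \<phi>)"
  by (auto simp: group_rel_rooted_chain)

lemma height_Suc_cases:
  assumes "height C k = Suc h"
  obtains j where "k = Suc j" "Suc j \<notin> C" "height C j = h"
  using assms by (cases k) (auto split: if_splits)

lemma sat_boxes_chain:
  "b \<in> K \<Longrightarrow> sat (rooted_chain J K A C) (Suc k) (boxes b n) \<longleftrightarrow> height C k < n"
proof (induction n arbitrary: k)
  case (Suc n)
  show ?case
  proof (cases "height C k")
    case 0
    then show ?thesis
      using sat_Dist_chain_0[of "{b}" C k] by simp
  next
    case (Suc h)
    then obtain j where j: "k = Suc j" "Suc j \<notin> C" "height C j = h"
      by (rule height_Suc_cases)
    then show ?thesis
      using Suc.prems by (simp add: sat_Dist_chain_Suc Suc.IH del: sat.simps)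
  qed
qed simp

lemma height_empty [simp]: "height {} k = k"
  by (induction k) auto

section \<open>Heights after an announcement\<close>

lemma height_sever_le: "height (sever C X) k \<le> height C k"
  by (induction k) (auto simp: Suc_in_sever_iff)

lemma height_sever_coherent_eq:
  assumes "height C k = height C' k'"
    and "\<And>j j'. height C j = height C' j' \<Longrightarrow> Suc j \<in> X \<longleftrightarrow> Suc j' \<in> X'"
  shows "height (sever C X) k = height (sever C' X') k'"
  using assms(1)
proof (induction "height C k" arbitrary: k k')
  case 0
  then show ?case
    using height_sever_le[of C X k] height_sever_le[of C' X' k'] by simp
next
  case (Suc h)
  obtain j where j: "k = Suc j" "Suc j \<notin> C" "height C j = h"
    using Suc.hyps(2) by (metis height_Suc_cases)
  obtain j' where j': "k' = Suc j'" "Suc j' \<notin> C'" "height C' j' = h"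
    using Suc.hyps(2) Suc.prems by (metis height_Suc_cases)
  have "height (sever C X) j = height (sever C' X') j'"
    using Suc.hyps(1) j(3) j'(3) by simp
  moreover have "Suc j \<in> X \<longleftrightarrow> Suc j' \<in> X'" "Suc k \<in> X \<longleftrightarrow> Suc k' \<in> X'"
    using assms(2) j(3) j'(3) Suc.prems by simp_all
  ultimately show ?case
    using j j' by (simp add: Suc_in_sever_iff)
qed

text \<open>\<open>X\<close> does not distinguish heights from \<open>r\<close> on, so a path
  starting at height \<open>r + s\<close> or more loses none of its first \<open>s\<close>
  edges.\<close>

lemma height_sever_ge:
  assumes "r + s \<le> height C k"
    and "\<And>j j'. r \<le> height C j \<Longrightarrow> r \<le> height C j' \<Longrightarrow> Suc j \<in> X \<longleftrightarrow> Suc j' \<in> X"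
  shows "s \<le> height (sever C X) k"
  using assms(1)
proof (induction s arbitrary: k)
  case (Suc s)
  then obtain h where "height C k = Suc h" "r + s \<le> h"
    by (cases "height C k") auto
  then obtain j where j: "k = Suc j" "Suc j \<notin> C" "r + s \<le> height C j"
    by (metis height_Suc_cases)
  have "Suc j \<in> X \<longleftrightarrow> Suc k \<in> X"
    using assms(2) j(3) Suc.prems by simp
  then show ?case
    using j Suc.IH[of j] by (simp add: Suc_in_sever_iff)
qed simp

text \<open>In the applications \<open>X\<close> and \<open>X'\<close> are the truth sets of an
  announced formula of size \<open>r\<close>, and \<open>s\<close> is the size of the formula
  evaluated afterwards. Equal heights are cut alike; different ones are both at least
  \<open>r + s\<close>, and then both keep at least \<open>s\<close>.\<close>

lemma height_sever_coherent:
  assumes "min (height C k) (r + s) = min (height C' k') (r + s)"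
    and "\<And>j j'. min (height C j) r = min (height C' j') r \<Longrightarrow> Suc j \<in> X \<longleftrightarrow> Suc j' \<in> X'"
    and "\<And>j j'. min (height C j) r = min (height C j') r \<Longrightarrow> Suc j \<in> X \<longleftrightarrow> Suc j' \<in> X"
    and "\<And>j j'. min (height C' j) r = min (height C' j') r \<Longrightarrow> Suc j \<in> X' \<longleftrightarrow> Suc j' \<in> X'"
  shows "min (height (sever C X) k) s = min (height (sever C' X') k') s"
proof (cases "height C k = height C' k'")
  case True
  have "height (sever C X) k = height (sever C' X') k'"
    by (rule height_sever_coherent_eq[OF True]) (simp add: assms(2))
  then show ?thesis
    by simp
next
  case False
  then have "r + s \<le> height C k" "r + s \<le> height C' k'"
    using assms(1) by linarith+
  then have "s \<le> height (sever C X) k" "s \<le> height (sever C' X') k'"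
    by (auto intro!: height_sever_ge[where r = r] assms(3,4) simp: min_absorb2)
  then show ?thesis
    by simp
qed

text \<open>At most one edge of the path is cut, the one from height \<open>c\<close> to
  \<open>c - 1\<close>.\<close>

lemma height_sever_below:
  assumes "\<And>j. Suc j \<in> X \<longleftrightarrow> c \<le> height C j" and "c \<le> height C k"
  shows "height (sever C X) k = height C k - c"
  using assms(2)
proof (induction k)
  case (Suc k)
  then show ?case
    by (cases "c \<le> height C k")
      (auto simp: Suc_in_sever_iff assms(1) Suc_diff_le split: if_splits)
qed simp

lemma height_sever_above:
  assumes "\<And>j. Suc j \<in> X \<longleftrightarrow> height C j < c" and "height C k < c"
  shows "height (sever C X) k = height C k"
  using assms(2)
  by (induction k) (auto simp: Suc_in_sever_iff assms(1) split: if_splits)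

definition closed :: "nat set \<Rightarrow> nat set \<Rightarrow> bool" where
  "closed A C \<longleftrightarrow> (\<forall>k. Suc k \<in> A \<longrightarrow> Suc k \<notin> C \<longrightarrow> k \<in> A)"

text \<open>A chain edge that survives has both ends on the same side of \<open>X\<close>, so the
  root keeps its edges to both or to neither.\<close>

lemma closed_announce:
  "closed A C \<Longrightarrow> closed {k \<in> A. Suc k \<in> X \<longleftrightarrow> z \<in> X} (sever C X)"
  by (auto simp: closed_def Suc_in_sever_iff)

lemma closed_height:
  assumes "closed A C" and "k \<in> A" and "n \<le> height C k"
  shows "n \<in> height C ` A"
  using assms(2,3)
proof (induction k)
  case (Suc k)
  show ?case
  proof (cases "n = height C (Suc k)")
    case True
    then show ?thesis
      using Suc.prems(1) by blast
  next
    case False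
    then have "Suc k \<notin> C" "n \<le> height C k"
      using Suc.prems(2) by (auto split: if_splits)
    then show ?thesis
      using Suc assms(1) by (simp add: closed_def)
  qed
qed force

text \<open>Visible heights are downward closed, so the truncation of a visible height at
  \<open>t\<close> is itself visible, and hence visible in the other model too.\<close>

lemma closed_match:
  assumes "closed A C" and "closed A' C'" and "k \<in> A"
    and "\<forall>n < Suc t. n \<in> height C ` A \<longleftrightarrow> n \<in> height C' ` A'"
  shows "\<exists>k'\<in>A'. min (height C k) t = min (height C' k') t"
proof -
  have "min (height C k) t \<in> height C ` A"
    using closed_height[OF assms(1,3)] by simp
  moreover have "min (height C k) t < Suc t"
    by simp
  ultimately have "min (height C k) t \<in> height C' ` A'"
    using assms(4) by blast
  then obtain k' where "k' \<in> A'" "min (height C k) t = height C' k'"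
    by blast
  then show ?thesis
    by (metis min.left_idem min.commute)
qed

lemma min_eq_mono: "min a t = min b t \<Longrightarrow> s \<le> t \<Longrightarrow> min a s = min b (s :: nat)"
  by linarith

section \<open>Announcements do not distinguish large heights\<close>

abbreviation truth_set :: "('w, 'a, 'p) model \<Rightarrow> ('a, 'p) fm \<Rightarrow> 'w set" where
  "truth_set M \<phi> \<equiv> {u \<in> worlds M. sat M u \<phi>}"

text \<open>An announcement can only lower a height, and announcing that the height is at least
  \<open>c\<close> lowers it by exactly \<open>c\<close> where this is true.\<close>

lemma announce_chain_match:
  fixes b :: 'a
  assumes "b \<in> K"
    and "min (height C k) s = min (height C' k') s"
  shows "\<exists>\<chi>\<in>(L_D :: ('a, 'p) fm set). sat (rooted_chain J K A' C') (Suc k') \<chi> \<and>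
    min (height (sever C X) k) s =
    min (height (sever C' (truth_set (rooted_chain J K A' C') \<chi>)) k') s"
proof -
  \<comment> \<open>Truncated subtraction: \<open>c\<close> is \<open>0\<close> if the wanted height
    exceeds \<open>height C' k'\<close>; then both are at least \<open>s\<close>, and nothing has to
    be cut.\<close>
  define c where "c = height C' k' - height (sever C X) k"
  define \<chi> :: "('a, 'p) fm" where "\<chi> = Neg (boxes b c)"
  have sat: "sat (rooted_chain J K A' C') (Suc j) \<chi> \<longleftrightarrow> c \<le> height C' j" for j
    using assms(1) by (auto simp: \<chi>_def sat_boxes_chain not_less)
  have "height (sever C' (truth_set (rooted_chain J K A' C') \<chi>)) k' = height C' k' - c"
    by (rule height_sever_below) (auto simp: sat c_def)
  moreover have "min (height (sever C X) k) s = min (height C' k' - c) s"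
    using assms(2) height_sever_le[of C X k] by (auto simp: c_def min_def split: if_splits)
  moreover have "\<chi> \<in> L_D"
    by (simp add: \<chi>_def L_D.intros)
  moreover have "c \<le> height C' k'"
    by (simp add: c_def)
  ultimately show ?thesis
    using sat by (metis (no_types, lifting))
qed

text \<open>\<open>Dist\<close> descends by one edge, \<open>Ann\<close> is covered by
  \<open>height_sever_coherent\<close> and \<open>AAnn\<close> by
  \<open>announce_chain_match\<close>. \<open>A\<close> and \<open>A'\<close> are unrelated since no
  chain world sees the root.\<close>

lemma bang_star_chain_invariant:
  assumes "b \<in> K" and "bang_star_fm \<phi>"
    and "min (height C k) (size \<phi>) = min (height C' k') (size \<phi>)"
  shows "sat (rooted_chain J K A C) (Suc k) \<phi> \<longleftrightarrow> sat (rooted_chain J K A' C') (Suc k') \<phi>"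
  using assms(2,3)
proof (induction \<phi> arbitrary: A C k A' C' k')
  case (Neg \<phi>)
  have "min (height C k) (size \<phi>) = min (height C' k') (size \<phi>)"
    using min_eq_mono[OF Neg.prems(2)] by simp
  then show ?case
    using Neg.IH[of C k C' k' A A'] Neg.prems(1) by simp
next
  case (Conj \<phi> \<psi>)
  have "min (height C k) (size \<phi>) = min (height C' k') (size \<phi>)"
    "min (height C k) (size \<psi>) = min (height C' k') (size \<psi>)"
    using Conj.prems(2) by (auto simp: min_def split: if_splits)
  then show ?case
    using Conj.IH Conj.prems(1) by (metis bang_star_fm.simps(3) sat.simps(3))
next
  case (Dist G \<phi>)
  then have G: "G \<noteq> {}"
    by simp
  show ?case
  proof (cases "height C k = 0")
    case True
    then have "height C' k' = 0"
      using Dist.prems(2) by (simp add: min_def split: if_splits)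
    then show ?thesis
      using True sat_Dist_chain_0[OF G] by blast
  next
    case False
    then have "height C' k' \<noteq> 0"
      using Dist.prems(2) by (auto simp: min_def split: if_splits)
    then obtain j j' where j: "k = Suc j" "Suc j \<notin> C" "k' = Suc j'" "Suc j' \<notin> C'"
      using False by (metis height_Suc_cases not0_implies_Suc)
    then have "min (height C j) (size \<phi>) = min (height C' j') (size \<phi>)"
      using Dist.prems(2) by simp
    then show ?thesis
      using Dist.IH[of C j C' j' A A'] Dist.prems(1) j
      by (simp add: sat_Dist_chain_Suc[OF G] del: sat.simps)
  qed
next
  case (Ann \<xi> \<phi>)
  let ?X = "truth_set (rooted_chain J K A C) \<xi>" and ?X' = "truth_set (rooted_chain J K A' C') \<xi>"
  have bang: "bang_star_fm \<xi>" "bang_star_fm \<phi>"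
    using Ann.prems(1) by simp_all
  have "min (height C k) (size \<xi> + size \<phi>) = min (height C' k') (size \<xi> + size \<phi>)"
    using Ann.prems(2) by (auto simp: min_def split: if_splits)
  then have "min (height (sever C ?X) k) (size \<phi>) = min (height (sever C' ?X') k') (size \<phi>)"
    by (rule height_sever_coherent) (auto dest: Ann.IH(1)[OF bang(1)])
  moreover have "sat (rooted_chain J K A C) (Suc k) \<xi> \<longleftrightarrow> sat (rooted_chain J K A' C') (Suc k') \<xi>"
    by (rule Ann.IH(1)[OF bang(1)]) (use Ann.prems(2) in \<open>auto simp: min_def split: if_splits\<close>)
  ultimately show ?case
    unfolding sat.simps announce_rooted_chain using Ann.IH(2)[OF bang(2)] by blast
next
  case (AAnn \<phi>)
  have bang: "bang_star_fm \<phi>"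
    using AAnn.prems(1) by simp
  have imp: "sat (rooted_chain J K A C) (Suc k) (AAnn \<phi>)"
    if heights: "min (height C k) (size \<phi>) = min (height C' k') (size \<phi>)"
      and sat: "sat (rooted_chain J K A' C') (Suc k') (AAnn \<phi>)" for A C k A' C' k'
    unfolding sat.simps announce_rooted_chain
  proof (intro ballI impI)
    fix \<chi> :: "('a, 'b) fm"
    let ?X = "truth_set (rooted_chain J K A C) \<chi>"
    obtain \<chi>' :: "('a, 'b) fm" where \<chi>': "\<chi>' \<in> L_D" "sat (rooted_chain J K A' C') (Suc k') \<chi>'"
      "min (height (sever C ?X) k) (size \<phi>) =
       min (height (sever C' (truth_set (rooted_chain J K A' C') \<chi>')) k') (size \<phi>)"
      using announce_chain_match[OF assms(1) heights, of J A' ?X] by blast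
    show "sat (rooted_chain J K {k \<in> A. Suc k \<in> ?X \<longleftrightarrow> 0 \<in> ?X} (sever C ?X)) (Suc k) \<phi>"
      using sat \<chi>'(1,2) AAnn.IH[OF bang \<chi>'(3)]
      unfolding sat.simps announce_rooted_chain by blast
  qed
  have heights: "min (height C k) (size \<phi>) = min (height C' k') (size \<phi>)"
    using min_eq_mono[OF AAnn.prems(2)] by simp
  show ?case
    using imp[OF heights] imp[OF heights[symmetric]] by blast
next
  case (Atom p)
  show ?case
    by simp
next
  case (PComm S \<chi> \<phi>)
  from PComm.prems(1) show ?case
    by simp
next
  case (APComm S \<phi>)
  from APComm.prems(1) show ?case
    by simp
qed

text \<open>After any announcement the visible heights form an initial segment contained in the old
  one. Up to \<open>s\<close>, announcing the root together with all heights below a bound produces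
  it in the other model.\<close>

lemma announce_root_match:
  fixes b :: 'a
  assumes "b \<in> K" and "closed A C" and "closed A' C'"
    and "\<forall>n < s. n \<in> height C ` A \<longleftrightarrow> n \<in> height C' ` A'"
    and "A1 = {k \<in> A. Suc k \<in> X \<longleftrightarrow> 0 \<in> X}"
  shows "\<exists>\<chi>\<in>(L_D :: ('a, 'p) fm set). sat (rooted_chain J K A' C') 0 \<chi> \<and>
    (\<forall>n < s. n \<in> height (sever C X) ` A1 \<longleftrightarrow> n \<in> height (sever C' (truth_set (rooted_chain J K A' C') \<chi>)) `
       {k \<in> A'. sat (rooted_chain J K A' C') (Suc k) \<chi>})"
proof -
  let ?H = "height C ` A" and ?H' = "height C' ` A'" and ?H1 = "height (sever C X) ` A1"
  have closed1: "closed A1 (sever C X)"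
    using closed_announce[OF assms(2)] assms(5) by simp
  have sub: "?H1 \<subseteq> ?H"
    using closed_height[OF assms(2)] height_sever_le assms(5) by blast
  have down: "m \<in> ?H1" if "n \<in> ?H1" "m \<le> n" for m n
    using that closed_height[OF closed1] by blast
  \<comment> \<open>Cut off at the first height missing after the given announcement, or beyond \<open>s\<close>.\<close>
  define c where "c = (LEAST n. n \<notin> ?H1 \<or> s \<le> n)"
  have c: "c \<notin> ?H1 \<or> s \<le> c"
    unfolding c_def by (rule LeastI[of _ s]) simp
  have below: "n \<in> ?H1 \<and> n < s" if "n < c" for n
    using not_less_Least[OF that[unfolded c_def]] by simp
  \<comment> \<open>The atom holds at the root only and keeps the root on the announced
    side.\<close>
  define \<chi> :: "('a, 'p) fm" where "\<chi> = Neg (Conj (Neg (Atom undefined)) (Neg (boxes b c)))"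
  have root: "sat (rooted_chain J K A' C') 0 \<chi>"
    by (simp add: \<chi>_def)
  have sat: "sat (rooted_chain J K A' C') (Suc j) \<chi> \<longleftrightarrow> height C' j < c" for j
    using assms(1) by (simp add: \<chi>_def sat_boxes_chain)
  have "height (sever C' (truth_set (rooted_chain J K A' C') \<chi>)) k = height C' k"
    if "height C' k < c" for k
    by (rule height_sever_above[OF _ that]) (simp add: sat)
  then have "height (sever C' (truth_set (rooted_chain J K A' C') \<chi>)) `
       {k \<in> A'. sat (rooted_chain J K A' C') (Suc k) \<chi>} = {n \<in> ?H'. n < c}"
    unfolding sat by force
  moreover have "n \<in> ?H1 \<longleftrightarrow> n \<in> {n \<in> ?H'. n < c}" if "n < s" for n
  proof
    assume "n \<in> ?H1"
    moreover from this have "n < c"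
      using c down that by (meson le_less_trans not_le order.trans)
    ultimately show "n \<in> {n \<in> ?H'. n < c}"
      using sub assms(4) that by blast
  qed (use below in simp)
  moreover have "\<chi> \<in> L_D"
    by (simp add: \<chi>_def L_D.intros)
  ultimately show ?thesis
    using root by (metis (no_types, lifting))
qed

text \<open>The root sees only chain worlds, and \<open>closed_match\<close> gives each of them a
  partner of the same truncated height, to which \<open>bang_star_chain_invariant\<close>
  applies.\<close>

lemma bang_star_root_invariant:
  assumes "b \<in> K" and "bang_star_fm \<phi>" and "closed A C" and "closed A' C'"
    and "\<forall>n < size \<phi>. n \<in> height C ` A \<longleftrightarrow> n \<in> height C' ` A'"
  shows "sat (rooted_chain J K A C) 0 \<phi> \<longleftrightarrow> sat (rooted_chain J K A' C') 0 \<phi>"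
  using assms(2-)
proof (induction \<phi> arbitrary: A C A' C')
  case (Conj \<phi> \<psi>)
  have "\<forall>n < size \<phi>. n \<in> height C ` A \<longleftrightarrow> n \<in> height C' ` A'"
    "\<forall>n < size \<psi>. n \<in> height C ` A \<longleftrightarrow> n \<in> height C' ` A'"
    using Conj.prems(4) by simp_all
  then show ?case
    using Conj.IH(1)[of A C A' C'] Conj.IH(2)[of A C A' C'] Conj.prems(1-3) by simp
next
  case (Dist G \<phi>)
  then have G: "G \<noteq> {}" and bang: "bang_star_fm \<phi>"
    by simp_all
  have imp: "sat (rooted_chain J K A C) 0 (Dist G \<phi>)"
    if closed: "closed A C" "closed A' C'"
      and eq: "\<forall>n < Suc (size \<phi>). n \<in> height C ` A \<longleftrightarrow> n \<in> height C' ` A'"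
      and sat: "sat (rooted_chain J K A' C') 0 (Dist G \<phi>)" for A C A' C'
    unfolding sat_Dist_root[OF G]
  proof (intro impI ballI)
    fix k
    assume "G \<subseteq> J" "k \<in> A"
    then obtain k' where "k' \<in> A'" "min (height C k) (size \<phi>) = min (height C' k') (size \<phi>)"
      using closed_match[OF closed _ eq] by blast
    then show "sat (rooted_chain J K A C) (Suc k) \<phi>"
      using sat \<open>G \<subseteq> J\<close> bang_star_chain_invariant[OF assms(1) bang]
      unfolding sat_Dist_root[OF G] by blast
  qed
  show ?case
    using imp[of A C A' C'] imp[of A' C' A C] Dist.prems(2-) by auto
next
  case (Ann \<xi> \<phi>)
  have bang: "bang_star_fm \<xi>" "bang_star_fm \<phi>"
    using Ann.prems(1) by simp_all
  have \<xi>: "sat (rooted_chain J K A C) 0 \<xi> \<longleftrightarrow> sat (rooted_chain J K A' C') 0 \<xi>"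
    by (rule Ann.IH(1)[OF bang(1) Ann.prems(2,3)]) (use Ann.prems(4) in simp)
  \<comment> \<open>The partner of a visible world satisfies \<xi> as well, and after the
    announcement the two heights agree up to truncation at \<open>size \<phi>\<close>, hence exactly
    if one is smaller than that.\<close>
  have new: "n \<in> height (sever C' (truth_set (rooted_chain J K A' C') \<xi>)) `
      {k \<in> A'. sat (rooted_chain J K A' C') (Suc k) \<xi>}"
    if closed: "closed A C" "closed A' C'"
      and eq: "\<forall>n < Suc (size \<xi> + size \<phi>). n \<in> height C ` A \<longleftrightarrow> n \<in> height C' ` A'"
      and n: "n < size \<phi>" "n \<in> height (sever C (truth_set (rooted_chain J K A C) \<xi>)) `
        {k \<in> A. sat (rooted_chain J K A C) (Suc k) \<xi>}" for A C A' C' n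
  proof -
    let ?X = "truth_set (rooted_chain J K A C) \<xi>" and ?X' = "truth_set (rooted_chain J K A' C') \<xi>"
    obtain k where k: "k \<in> A" "sat (rooted_chain J K A C) (Suc k) \<xi>" "n = height (sever C ?X) k"
      using n(2) by blast
    obtain k' where k': "k' \<in> A'"
      "min (height C k) (size \<xi> + size \<phi>) = min (height C' k') (size \<xi> + size \<phi>)"
      using closed_match[OF closed k(1) eq] by blast
    have "min (height (sever C ?X) k) (size \<phi>) = min (height (sever C' ?X') k') (size \<phi>)"
      using k'(2)
      by (rule height_sever_coherent) (auto dest: bang_star_chain_invariant[OF assms(1) bang(1)])
    then have "height (sever C' ?X') k' = n"
      using n(1) k(3) by (simp add: min_def split: if_splits)
    moreover have "sat (rooted_chain J K A' C') (Suc k') \<xi>"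
    proof -
      have "min (height C k) (size \<xi>) = min (height C' k') (size \<xi>)"
        using k'(2) by (auto simp: min_def split: if_splits)
      then show ?thesis
        using k(2) bang_star_chain_invariant[OF assms(1) bang(1)] by blast
    qed
    ultimately show ?thesis
      using k'(1) by blast
  qed
  show ?case
  proof (cases "sat (rooted_chain J K A C) 0 \<xi>")
    case True
    let ?X = "truth_set (rooted_chain J K A C) \<xi>" and ?X' = "truth_set (rooted_chain J K A' C') \<xi>"
    have "sat (rooted_chain J K {k \<in> A. Suc k \<in> ?X \<longleftrightarrow> 0 \<in> ?X} (sever C ?X)) 0 \<phi> \<longleftrightarrow>
        sat (rooted_chain J K {k \<in> A'. Suc k \<in> ?X' \<longleftrightarrow> 0 \<in> ?X'} (sever C' ?X')) 0 \<phi>"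
      using new[of A C A' C'] new[of A' C' A C] Ann.prems True \<xi>
      by (intro Ann.IH(2)[OF bang(2)] closed_announce) auto
    then show ?thesis
      using True \<xi> unfolding sat.simps announce_rooted_chain by blast
  next
    case False
    then show ?thesis
      using \<xi> by simp
  qed
next
  case (AAnn \<phi>)
  have bang: "bang_star_fm \<phi>"
    using AAnn.prems(1) by simp
  have imp: "sat (rooted_chain J K A C) 0 (AAnn \<phi>)"
    if closed: "closed A C" "closed A' C'"
      and eq: "\<forall>n < size \<phi>. n \<in> height C ` A \<longleftrightarrow> n \<in> height C' ` A'"
      and sat: "sat (rooted_chain J K A' C') 0 (AAnn \<phi>)" for A C A' C'
    unfolding sat.simps announce_rooted_chain
  proof (intro ballI impI)
    fix \<chi> :: "('a, 'b) fm"
    let ?X = "truth_set (rooted_chain J K A C) \<chi>"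
    let ?A1 = "{k \<in> A. Suc k \<in> ?X \<longleftrightarrow> 0 \<in> ?X}"
    obtain \<chi>' :: "('a, 'b) fm" where \<chi>': "\<chi>' \<in> L_D" "sat (rooted_chain J K A' C') 0 \<chi>'"
      "\<forall>n < size \<phi>. n \<in> height (sever C ?X) ` ?A1 \<longleftrightarrow>
         n \<in> height (sever C' (truth_set (rooted_chain J K A' C') \<chi>')) `
           {k \<in> A'. sat (rooted_chain J K A' C') (Suc k) \<chi>'}"
      using announce_root_match[OF assms(1) closed eq refl, of J ?X] by blast
    let ?X' = "truth_set (rooted_chain J K A' C') \<chi>'"
    have "sat (rooted_chain J K ?A1 (sever C ?X)) 0 \<phi> \<longleftrightarrow>
        sat (rooted_chain J K {k \<in> A'. Suc k \<in> ?X' \<longleftrightarrow> 0 \<in> ?X'} (sever C' ?X')) 0 \<phi>"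
      using \<chi>'(2,3) closed by (intro AAnn.IH[OF bang] closed_announce) auto
    then show "sat (rooted_chain J K ?A1 (sever C ?X)) 0 \<phi>"
      using sat \<chi>'(1,2) unfolding sat.simps announce_rooted_chain by blast
  qed
  show ?case
    using imp[of A C A' C'] imp[of A' C' A C] AAnn.prems(2-) by auto
next
  case (Atom p)
  show ?case
    by simp
next
  case (Neg \<phi>)
  show ?case
    using Neg.IH[of A C A' C'] Neg.prems by simp
next
  case (PComm S \<chi> \<phi>)
  from PComm.prems(1) show ?case
    by simp
next
  case (APComm S \<phi>)
  from APComm.prems(1) show ?case
    by simp
qed

section \<open>The two separations\<close>

lemma parity_definable:
  assumes "b \<in> K"
  shows "\<exists>\<chi>\<in>L_D. \<forall>k<n. sat (rooted_chain J K A {}) (Suc k) \<chi> \<longleftrightarrow> even k"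
proof (induction n)
  case 0
  show ?case
    using Bot_in_L_D by blast
next
  case (Suc n)
  then obtain \<chi> :: "('a, 'b) fm"
    where \<chi>: "\<chi> \<in> L_D" "\<forall>k<n. sat (rooted_chain J K A {}) (Suc k) \<chi> \<longleftrightarrow> even k"
    by blast
  \<comment> \<open>Below height \<open>n\<close> this agrees with \<chi>; from \<open>n\<close> on
    it is constant, with the value wanted at \<open>n\<close>.\<close>
  define \<chi>' where "\<chi>' = (if even n then Neg (Conj (boxes b n) (Neg \<chi>)) else Conj (boxes b n) \<chi>)"
  have "\<chi>' \<in> L_D"
    using \<chi>(1) by (simp add: \<chi>'_def L_D.intros)
  moreover have "\<forall>k<Suc n. sat (rooted_chain J K A {}) (Suc k) \<chi>' \<longleftrightarrow> even k"
    using \<chi>(2) by (auto simp: \<chi>'_def sat_boxes_chain[OF assms] less_Suc_eq)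
  ultimately show ?case
    by blast
qed

lemma L_star_not_le_L_bang_star:
  fixes a b :: 'a
  assumes "infinite (UNIV :: 'w set)" and "a \<noteq> b"
  shows "\<not> expr_le TYPE('w) (L_star :: ('a, 'p) fm set) L_bang_star"
proof (rule not_expr_le_natI[OF assms(1)])
  \<comment> \<open>Some communication by \<open>a\<close> leaves no world that \<open>a\<close>
    considers possible with a \<open>b\<close>-successor.\<close>
  let ?\<alpha> = "Neg (APComm {a} (Neg (Dist {a} (Dist {b} Bot)))) :: ('a, 'p) fm"
  have "?\<alpha> \<in> L_star_level 0"
    using star_over_if_L_D[OF Bot_in_L_D] by (auto intro!: star_over.intros)
  then show "?\<alpha> \<in> L_star"
    unfolding L_star_def by blast
  have b: "b \<in> - {a}"
    using assms(2) by simp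
  let ?M = "\<lambda>A. rooted_chain {a} (- {a}) A {} :: (nat, 'a, 'p) model"
  have \<alpha>: "sat (?M A) 0 ?\<alpha> \<longleftrightarrow>
      (\<exists>\<chi>\<in>L_D. \<forall>k\<in>A. height (sever {} (truth_set (?M A) \<chi>)) k = 0)" for A
  proof -
    have "sat (rooted_chain {a} (- {a}) A C :: (nat, 'a, 'p) model) (Suc k) (Dist {b} Bot) \<longleftrightarrow>
        height C k = 0" for C k
      using sat_boxes_chain[OF b, of "{a}" A C k 1] by simp
    then have "sat (rooted_chain {a} (- {a}) A C :: (nat, 'a, 'p) model) 0 (Dist {a} (Dist {b} Bot)) \<longleftrightarrow>
        (\<forall>k\<in>A. height C k = 0)" for C
      by (simp add: sat_Dist_root del: sat.simps)
    then show ?thesis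
      by (simp only: sat.simps(2,6) partial_comm_rooted_chain) blast
  qed
  fix \<beta> :: "('a, 'p) fm"
  assume "\<beta> \<in> L_bang_star"
  then have "bang_star_fm \<beta>"
    by (rule bang_star_fm_if_L_bang_star)
  then have "sat (?M {..<size \<beta>}) 0 \<beta> \<longleftrightarrow> sat (?M UNIV) 0 \<beta>"
    by (intro bang_star_root_invariant[OF b]) (auto simp: closed_def)
  moreover have "sat (?M {..<size \<beta>}) 0 ?\<alpha>"
  proof -
    obtain \<chi> :: "('a, 'p) fm" where \<chi>: "\<chi> \<in> L_D"
      "\<forall>k<size \<beta>. sat (?M {..<size \<beta>}) (Suc k) \<chi> \<longleftrightarrow> even k"
      using parity_definable[OF b] by blast
    \<comment> \<open>Parity changes along every edge of the visible segment, so all of them are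
      cut.\<close>
    have "height (sever {} (truth_set (?M {..<size \<beta>}) \<chi>)) k = 0" if "k < size \<beta>" for k
      using \<chi>(2) that by (cases k) (auto simp: Suc_in_sever_iff)
    then show ?thesis
      unfolding \<alpha> using \<chi>(1) by blast
  qed
  moreover have "\<not> sat (?M UNIV) 0 ?\<alpha>"
  proof
    assume "sat (?M UNIV) 0 ?\<alpha>"
    then obtain \<chi> where \<chi>: "\<chi> \<in> L_D" "height (sever {} (truth_set (?M UNIV) \<chi>)) (Suc (size \<chi>)) = 0"
      unfolding \<alpha> by blast
    \<comment> \<open>\<chi> cannot separate the heights \<open>size \<chi>\<close> and
      \<open>size \<chi> + 1\<close>, so the edge between them survives.\<close>
    have "sat (?M UNIV) (Suc (Suc (size \<chi>))) \<chi> \<longleftrightarrow> sat (?M UNIV) (Suc (size \<chi>)) \<chi>"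
      by (rule bang_star_chain_invariant[OF b bang_star_fm_if_L_D[OF \<chi>(1)]]) simp
    then show False
      using \<chi>(2) by (simp add: Suc_in_sever_iff split: if_splits)
  qed
  ultimately show "\<exists>(M :: (nat, 'a, 'p) model) (N :: (nat, 'a, 'p) model) u v.
      is_model M \<and> is_model N \<and> u \<in> worlds M \<and> v \<in> worlds N \<and>
      (sat M u \<beta> \<longleftrightarrow> sat N v \<beta>) \<and> sat M u ?\<alpha> \<and> \<not> sat N v ?\<alpha>"
    by (metis UNIV_I is_model_rooted_chain worlds_rooted_chain)
qed

section \<open>Chains with one relation for all agents\<close>

lemma star_chain_invariant:
  assumes "star_fm \<phi>" and "min k (size \<phi>) = min k' (size \<phi>)"
  shows "sat (rooted_chain UNIV UNIV A {}) (Suc k) \<phi> \<longleftrightarrow>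
    sat (rooted_chain UNIV UNIV A' {}) (Suc k') \<phi>"
  using assms
proof (induction \<phi> arbitrary: k k')
  case (Neg \<phi>)
  then show ?case
    using min_eq_mono[OF Neg.prems(2), of "size \<phi>"] by simp
next
  case (Conj \<phi> \<psi>)
  have "min k (size \<phi>) = min k' (size \<phi>)" "min k (size \<psi>) = min k' (size \<psi>)"
    using Conj.prems(2) by (auto simp: min_def split: if_splits)
  then show ?case
    using Conj.IH Conj.prems(1) by (metis star_fm.simps(3) sat.simps(3))
next
  case (Dist G \<phi>)
  then have G: "G \<noteq> {}"
    by simp
  show ?case
  proof (cases k)
    case 0
    then have "k' = 0"
      using Dist.prems(2) by (simp add: min_def split: if_splits)
    then show ?thesis
      using 0 sat_Dist_chain_0[OF G] height.simps(1) by metis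
  next
    case (Suc j)
    then obtain j' where "k' = Suc j'"
      using Dist.prems(2) by (cases k') (auto simp: min_def split: if_splits)
    then show ?thesis
      using Suc Dist by (simp add: sat_Dist_chain_Suc[OF G] del: sat.simps)
  qed
next
  case (PComm S \<chi> \<phi>)
  have "min k (size \<phi>) = min k' (size \<phi>)"
    using PComm.prems(2) by (auto simp: min_def split: if_splits)
  then show ?case
    using PComm.IH(2) PComm.prems(1) by (simp add: partial_comm_uniform_rooted_chain)
next
  case (APComm S \<phi>)
  have "min k (size \<phi>) = min k' (size \<phi>)"
    using APComm.prems(2) by (auto simp: min_def split: if_splits)
  then show ?case
    using APComm.IH APComm.prems(1) by (simp add: partial_comm_uniform_rooted_chain)
qed auto

text \<open>Communication is idle and all visible worlds are too high to be told apart.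
  Non-emptiness prevents \<open>Dist\<close> from holding vacuously on one side only.\<close>

lemma star_root_invariant:
  assumes "star_fm \<phi>" and "A \<noteq> {}" and "A' \<noteq> {}" and "\<forall>k \<in> A \<union> A'. size \<phi> \<le> k"
  shows "sat (rooted_chain UNIV UNIV A {}) 0 \<phi> \<longleftrightarrow> sat (rooted_chain UNIV UNIV A' {}) 0 \<phi>"
  using assms
proof (induction \<phi>)
  case (Dist G \<phi>)
  then have G: "G \<noteq> {}"
    by simp
  have "sat (rooted_chain UNIV UNIV A {}) (Suc k) \<phi> \<longleftrightarrow> sat (rooted_chain UNIV UNIV A' {}) (Suc k') \<phi>"
    if "k \<in> A" "k' \<in> A'" for k k'
    using that Dist.prems by (intro star_chain_invariant) (auto simp: min_absorb2 Suc_le_eq less_imp_le)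
  then show ?case
    using Dist.prems(2,3) unfolding sat_Dist_root[OF G] by blast
next
  case (PComm S \<chi> \<phi>)
  have "\<forall>k \<in> A \<union> A'. size \<phi> \<le> k"
    by (intro ballI, drule PComm.prems(4)[rule_format]) simp
  then show ?case
    using PComm.IH(2) PComm.prems(1-3) by (simp add: partial_comm_uniform_rooted_chain)
next
  case (APComm S \<phi>)
  have "\<forall>k \<in> A \<union> A'. size \<phi> \<le> k"
    by (intro ballI, drule APComm.prems(4)[rule_format]) simp
  then show ?case
    using APComm.IH APComm.prems(1-3) by (simp add: partial_comm_uniform_rooted_chain)
next
  case (Neg \<phi>)
  have "\<forall>k \<in> A \<union> A'. size \<phi> \<le> k"
    by (intro ballI, drule Neg.prems(4)[rule_format]) simp
  then show ?case
    using Neg.IH Neg.prems(1-3) by simp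
next
  case (Conj \<phi> \<psi>)
  have "\<forall>k \<in> A \<union> A'. size \<phi> \<le> k" "\<forall>k \<in> A \<union> A'. size \<psi> \<le> k"
    by (intro ballI, drule Conj.prems(4)[rule_format], simp)+
  then show ?case
    using Conj.IH Conj.prems(1-3) by simp
qed auto

lemma L_bang_star_not_le_L_star:
  assumes "infinite (UNIV :: 'w set)"
  shows "\<not> expr_le TYPE('w) (L_bang_star :: ('a, 'p) fm set) L_star"
proof (rule not_expr_le_natI[OF assms])
  fix a :: 'a
  \<comment> \<open>The root sees both a world with an \<open>a\<close>-successor and a world
    without.\<close>
  let ?\<psi> = "Conj (Neg (Dist {a} (Dist {a} Bot))) (Neg (Dist {a} (Neg (Dist {a} Bot)))) :: ('a, 'p) fm"
  let ?\<alpha> = "Neg (AAnn (Neg ?\<psi>))"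
  have "?\<alpha> \<in> L_bang_star_level 0"
    using bang_star_over_if_L_D[OF Bot_in_L_D] by (auto intro!: bang_star_over.intros)
  then show "?\<alpha> \<in> L_bang_star"
    unfolding L_bang_star_def by blast
  let ?M = "\<lambda>A. rooted_chain UNIV UNIV A {} :: (nat, 'a, 'p) model"
  have \<psi>: "sat (rooted_chain UNIV UNIV A C :: (nat, 'a, 'p) model) 0 ?\<psi> \<longleftrightarrow>
      (\<exists>k\<in>A. height C k \<noteq> 0) \<and> (\<exists>k\<in>A. height C k = 0)" for A C
  proof -
    have "sat (rooted_chain UNIV UNIV A C :: (nat, 'a, 'p) model) (Suc k) (Dist {a} Bot) \<longleftrightarrow>
        height C k = 0" for k
      using sat_boxes_chain[of a UNIV UNIV A C k 1] by simp
    then show ?thesis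
      by (simp add: sat_Dist_root del: sat.simps(4))
  qed
  fix \<beta> :: "('a, 'p) fm"
  assume "\<beta> \<in> L_star"
  then have "star_fm \<beta>"
    by (rule star_fm_if_L_star)
  \<comment> \<open>The successor makes \<open>n\<close> positive, so that a world of height
    \<open>n\<close> has a successor.\<close>
  define n where "n = Suc (size \<beta>)"
  have "sat (?M {n, n + 2}) 0 \<beta> \<longleftrightarrow> sat (?M {n + 2}) 0 \<beta>"
    by (rule star_root_invariant[OF \<open>star_fm \<beta>\<close>]) (auto simp: n_def)
  moreover have "sat (?M {n, n + 2}) 0 ?\<alpha>"
  proof -
    \<comment> \<open>This fails exactly at height \<open>n + 1\<close>. Announcing it cuts the edge
      below \<open>n + 2\<close> and leaves the path below \<open>n\<close> intact, while the root
      keeps both \<open>n\<close> and \<open>n + 2\<close>; the gap of two makes room for the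
      excluded world.\<close>
    define \<chi> :: "('a, 'p) fm"
      where "\<chi> = Neg (Conj (Neg (Atom undefined)) (Conj (boxes a (n + 2)) (Neg (boxes a (n + 1)))))"
    define X where "X = truth_set (?M {n, n + 2}) \<chi>"
    have root: "0 \<in> X"
      by (simp add: X_def \<chi>_def)
    have chain: "Suc k \<in> X \<longleftrightarrow> k \<noteq> n + 1" for k
      using sat_boxes_chain[of a UNIV UNIV "{n, n + 2}" "{}"]
      by (auto simp: X_def \<chi>_def simp del: funpow.simps)
    have below: "height (sever {} X) k = k" if "k \<le> n" for k
      using that by (induction k) (auto simp: Suc_in_sever_iff chain)
    have "height (sever {} X) n \<noteq> 0"
      using below[of n] by (simp add: n_def del: height.simps)
    moreover have "height (sever {} X) (n + 2) = 0"
      by (simp add: Suc_in_sever_iff chain)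
    ultimately have "sat (announce (?M {n, n + 2}) X) 0 ?\<psi>"
      unfolding announce_rooted_chain \<psi> by (auto simp: root chain)
    moreover have "\<chi> \<in> L_D"
      unfolding \<chi>_def by (intro L_D.intros boxes_in_L_D)
    moreover have "sat (?M {n, n + 2}) 0 \<chi>"
      using root by (simp add: X_def)
    ultimately show ?thesis
      unfolding X_def by (subst sat.simps, subst sat.simps(8), subst sat.simps(7), subst sat.simps(2)) blast
  qed
  moreover have "\<not> sat (?M {n + 2}) 0 ?\<alpha>"
  proof -
    \<comment> \<open>At most one world is visible, and its height cannot be both zero and
      non-zero.\<close>
    have "\<not> sat (announce (?M {n + 2}) X) 0 ?\<psi>" for X
      unfolding announce_rooted_chain \<psi> by auto
    then show ?thesis
      by (subst sat.simps, subst sat.simps(8), subst sat.simps(7), subst sat.simps(2)) blast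
  qed
  ultimately show "\<exists>(M :: (nat, 'a, 'p) model) (N :: (nat, 'a, 'p) model) u v.
      is_model M \<and> is_model N \<and> u \<in> worlds M \<and> v \<in> worlds N \<and>
      (sat M u \<beta> \<longleftrightarrow> sat N v \<beta>) \<and> sat M u ?\<alpha> \<and> \<not> sat N v ?\<alpha>"
    by (metis UNIV_I is_model_rooted_chain worlds_rooted_chain)
qed

theorem theorem4p10:
  assumes "CARD('a::finite) \<ge> 2"
    and "infinite (UNIV :: 'w set)"
  shows "\<not> expr_le TYPE('w) (L_star :: ('a, 'p::countable) fm set) L_bang_star \<and>
         \<not> expr_le TYPE('w) (L_bang_star :: ('a, 'p) fm set) L_star"
proof -
  have "\<not> CARD('a) \<le> Suc 0"
    using assms(1) by simp
  then obtain a b :: 'a where "a \<noteq> b"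
    by (auto simp: card_le_Suc0_iff_eq)
  then show ?thesis
    by (intro conjI L_star_not_le_L_bang_star[OF assms(2)] L_bang_star_not_le_L_star[OF assms(2)])
qed

end
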